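(* Let $M$ be an abelian group, and let $UM$ be the group and $s\colon M\to UM$, $m\mapsto 1+m$, the map defined in the context. (i) The composition $M\xrightarrow{s}UM\to(UM)^{\mathrm{ab}}$ is universal for quadratic maps from $M$ to an abelian group: it is a quadratic map, and every quadratic map from $M$ to an abelian group $G$ factors through it via a unique group homomorphism $(UM)^{\mathrm{ab}}\to G$. (ii) The composition $M\xrightarrow{s}UM\to(UM)^{\mathrm{ab}}\otimes\mathbb{F}_2$ is universal, in the same sense, for quadratic maps from $M$ to an abelian group such that the image is killed by $2$.
   Context: A quadratic map $q\colon M\to G$ is a set map between abelian groups such that $(m,m')\mapsto q(m+m')-q(m)-q(m')$ is bilinear. For an abelian group ($\mathbb{Z}$-module) $M$, let $TM=\bigoplus_{i\ge0}T^iM$ be the tensor algebra over $\mathbb{Z}$, $T^{\ge n}M=\bigoplus_{i\ge n}T^iM$, $T^{<n}M=TM/T^{\ge n}M$, and let $UM$ be the kernel of $(T^{<3}M)^\times\to(T^{<1}M)^\times=\mathbb{Z}^\times=\{\pm1\}$. Elements of $UM$ are the expressions $1+m+t$ with $m\in M$, $t\in M\otimes M$, with multiplication $(1+m+t)(1+m'+t')=1+(m+m')+((m\otimes m')+t+t')$. The map $s\colon M\to UM$ sends $m$ to $1+m$. $(UM)^{\mathrm{ab}}$ is the abelianization of $UM$, and $\otimes$ is over $\mathbb{Z}$. *)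

theory Defs
  imports
    "HOL-Algebra.Free_Abelian_Groups"
    "HOL-Algebra.Elementary_Groups"
    "HOL-Algebra.Generated_Groups"
    "HOL-Algebra.IntRing"
begin

text \<open>
  Abelian groups are \<^locale>\<open>comm_group\<close>s and hence written multiplicatively: the sum
  \<open>m + m'\<close> of the mathematics is \<open>m \<otimes> m'\<close>, the multiple \<open>k m\<close> is the power \<open>m [^] k\<close>.
  The symbol \<open>\<otimes>\<close> is always the operation of a monoid record, never a tensor.
\<close>

definition bilinear_map ::
  "('a, 'm) monoid_scheme \<Rightarrow> ('b, 'n) monoid_scheme \<Rightarrow> ('c, 'k) monoid_scheme
     \<Rightarrow> ('a \<Rightarrow> 'b \<Rightarrow> 'c) \<Rightarrow> bool" where
  "bilinear_map M N G b \<longleftrightarrow>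
     (\<forall>m\<in>carrier M. \<forall>n\<in>carrier N. b m n \<in> carrier G) \<and>
     (\<forall>m\<in>carrier M. \<forall>m'\<in>carrier M. \<forall>n\<in>carrier N.
        b (m \<otimes>\<^bsub>M\<^esub> m') n = b m n \<otimes>\<^bsub>G\<^esub> b m' n) \<and>
     (\<forall>m\<in>carrier M. \<forall>n\<in>carrier N. \<forall>n'\<in>carrier N.
        b m (n \<otimes>\<^bsub>N\<^esub> n') = b m n \<otimes>\<^bsub>G\<^esub> b m n')"

definition quadratic_map ::
  "('a, 'm) monoid_scheme \<Rightarrow> ('b, 'n) monoid_scheme \<Rightarrow> ('a \<Rightarrow> 'b) \<Rightarrow> bool" where
  "quadratic_map M G q \<longleftrightarrow>
     comm_group M \<and> comm_group G \<and> q \<in> carrier M \<rightarrow> carrier G \<and>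
     bilinear_map M M G (\<lambda>m m'. q (m \<otimes>\<^bsub>M\<^esub> m') \<otimes>\<^bsub>G\<^esub> inv\<^bsub>G\<^esub> q m \<otimes>\<^bsub>G\<^esub> inv\<^bsub>G\<^esub> q m')"

definition tensor_relators ::
  "('a, 'm) monoid_scheme \<Rightarrow> ('b, 'n) monoid_scheme \<Rightarrow> ('a \<times> 'b \<Rightarrow>\<^sub>0 int) set" where
  "tensor_relators M N =
     {frag_of (m \<otimes>\<^bsub>M\<^esub> m', n) - frag_of (m, n) - frag_of (m', n) | m m' n.
        m \<in> carrier M \<and> m' \<in> carrier M \<and> n \<in> carrier N} \<union>
     {frag_of (m, n \<otimes>\<^bsub>N\<^esub> n') - frag_of (m, n) - frag_of (m, n') | m n n'.
        m \<in> carrier M \<and> n \<in> carrier N \<and> n' \<in> carrier N}"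

definition tensor_kernel ::
  "('a, 'm) monoid_scheme \<Rightarrow> ('b, 'n) monoid_scheme \<Rightarrow> ('a \<times> 'b \<Rightarrow>\<^sub>0 int) set" where
  "tensor_kernel M N =
     generate (free_Abelian_group (carrier M \<times> carrier N)) (tensor_relators M N)"

definition tensor_product ::
  "('a, 'm) monoid_scheme \<Rightarrow> ('b, 'n) monoid_scheme \<Rightarrow> ('a \<times> 'b \<Rightarrow>\<^sub>0 int) set monoid" where
  "tensor_product M N =
     free_Abelian_group (carrier M \<times> carrier N) Mod tensor_kernel M N"

definition pure_tensor ::
  "('a, 'm) monoid_scheme \<Rightarrow> ('b, 'n) monoid_scheme \<Rightarrow> 'a \<Rightarrow> 'b \<Rightarrow> ('a \<times> 'b \<Rightarrow>\<^sub>0 int) set" where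
  "pure_tensor M N m n =
     tensor_kernel M N #>\<^bsub>free_Abelian_group (carrier M \<times> carrier N)\<^esub> frag_of (m, n)"

text \<open>
  The ring \<open>T\<^sup><\<^sup>3M = TM / T\<^sup>\<ge>\<^sup>3M\<close> in terms of its homogeneous components: the triple
  \<open>(k, m, t)\<close> stands for \<open>k + m + t\<close> with \<open>k \<in> T\<^sup>0M = \<int>\<close>, \<open>m \<in> T\<^sup>1M = M\<close> and
  \<open>t \<in> T\<^sup>2M\<close>, and products landing in degree at least \<open>3\<close> are discarded.
\<close>

definition trunc_tensor_algebra ::
  "('a, 'm) monoid_scheme \<Rightarrow> (int \<times> 'a \<times> ('a \<times> 'a \<Rightarrow>\<^sub>0 int) set) ring" where
  "trunc_tensor_algebra M =
     (let T2 = tensor_product M M in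
      \<lparr>carrier = UNIV \<times> carrier M \<times> carrier T2,
       monoid.mult = (\<lambda>(k, m, t) (k', m', t').
         (k * k',
          m' [^]\<^bsub>M\<^esub> k \<otimes>\<^bsub>M\<^esub> m [^]\<^bsub>M\<^esub> k',
          t' [^]\<^bsub>T2\<^esub> k \<otimes>\<^bsub>T2\<^esub> pure_tensor M M m m' \<otimes>\<^bsub>T2\<^esub> t [^]\<^bsub>T2\<^esub> k')),
       one = (1, \<one>\<^bsub>M\<^esub>, \<one>\<^bsub>T2\<^esub>),
       zero = (0, \<one>\<^bsub>M\<^esub>, \<one>\<^bsub>T2\<^esub>),
       add = (\<lambda>(k, m, t) (k', m', t'). (k + k', m \<otimes>\<^bsub>M\<^esub> m', t \<otimes>\<^bsub>T2\<^esub> t'))\<rparr>)"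

text \<open>
  The projection onto \<open>T\<^sup><\<^sup>1M = \<int>\<close> is \<^const>\<open>fst\<close>.
\<close>

definition U_group ::
  "('a, 'm) monoid_scheme \<Rightarrow> (int \<times> 'a \<times> ('a \<times> 'a \<Rightarrow>\<^sub>0 int) set) monoid" where
  "U_group M =
     (units_of (trunc_tensor_algebra M))
       \<lparr>carrier := kernel (units_of (trunc_tensor_algebra M)) (units_of \<Z>) fst\<rparr>"

definition U_embed ::
  "('a, 'm) monoid_scheme \<Rightarrow> 'a \<Rightarrow> int \<times> 'a \<times> ('a \<times> 'a \<Rightarrow>\<^sub>0 int) set" where
  "U_embed M m = (1, m, \<one>\<^bsub>tensor_product M M\<^esub>)"

definition abelianization :: "('a, 'm) monoid_scheme \<Rightarrow> 'a set monoid" where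
  "abelianization G = G Mod derived G (carrier G)"

definition abelianization_map :: "('a, 'm) monoid_scheme \<Rightarrow> 'a \<Rightarrow> 'a set" where
  "abelianization_map G x = derived G (carrier G) #>\<^bsub>G\<^esub> x"

definition tensor_F2 :: "('a, 'm) monoid_scheme \<Rightarrow> ('a \<times> int \<Rightarrow>\<^sub>0 int) set monoid" where
  "tensor_F2 A = tensor_product A (integer_mod_group 2)"

definition tensor_F2_map :: "('a, 'm) monoid_scheme \<Rightarrow> 'a \<Rightarrow> ('a \<times> int \<Rightarrow>\<^sub>0 int) set" where
  "tensor_F2_map A a = pure_tensor A (integer_mod_group 2) a 1"

text \<open>
  The set \<^term>\<open>extensional (carrier A)\<close> only fixes the irrelevant values of the
  homomorphism outside \<^term>\<open>carrier A\<close>, so that \<open>\<exists>!\<close> expresses uniqueness on the carrier.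
\<close>

definition factors_uniquely ::
  "('a, 'm) monoid_scheme \<Rightarrow> ('b, 'n) monoid_scheme \<Rightarrow> ('a \<Rightarrow> 'b)
     \<Rightarrow> ('c, 'k) monoid_scheme \<Rightarrow> ('a \<Rightarrow> 'c) \<Rightarrow> bool" where
  "factors_uniquely M A u G q \<longleftrightarrow>
     (\<exists>!f. f \<in> hom A G \<inter> extensional (carrier A) \<and> (\<forall>m\<in>carrier M. f (u m) = q m))"

definition U_ab :: "('a, 'm) monoid_scheme \<Rightarrow> (int \<times> 'a \<times> ('a \<times> 'a \<Rightarrow>\<^sub>0 int) set) set monoid" where
  "U_ab M = abelianization (U_group M)"

definition U_ab_map ::
  "('a, 'm) monoid_scheme \<Rightarrow> 'a \<Rightarrow> (int \<times> 'a \<times> ('a \<times> 'a \<Rightarrow>\<^sub>0 int) set) set" where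
  "U_ab_map M m = abelianization_map (U_group M) (U_embed M m)"

definition U_ab_F2 ::
  "('a, 'm) monoid_scheme
     \<Rightarrow> ((int \<times> 'a \<times> ('a \<times> 'a \<Rightarrow>\<^sub>0 int) set) set \<times> int \<Rightarrow>\<^sub>0 int) set monoid" where
  "U_ab_F2 M = tensor_F2 (U_ab M)"

definition U_ab_F2_map ::
  "('a, 'm) monoid_scheme \<Rightarrow> 'a
     \<Rightarrow> ((int \<times> 'a \<times> ('a \<times> 'a \<Rightarrow>\<^sub>0 int) set) set \<times> int \<Rightarrow>\<^sub>0 int) set" where
  "U_ab_F2_map M m = tensor_F2_map (U_ab M) (U_ab_map M m)"

lemma comm_group_free_Abelian_group: "comm_group (free_Abelian_group S)"
  by (rule group.group_comm_groupI [OF group_free_Abelian_group])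
    (auto simp: free_Abelian_group_def add.commute)

lemma tensor_relators_subset:
  assumes "comm_group M" "comm_group N"
  shows "tensor_relators M N \<subseteq> carrier (free_Abelian_group (carrier M \<times> carrier N))"
proof -
  interpret M: comm_group M by fact
  interpret N: comm_group N by fact
  show ?thesis
    unfolding tensor_relators_def free_Abelian_group_def
    by (auto dest!: subsetD [OF keys_diff] simp: split: if_splits)
qed

lemma comm_group_tensor_product:
  assumes "comm_group M" "comm_group N"
  shows "comm_group (tensor_product M N)"
proof -
  let ?F = "free_Abelian_group (carrier M \<times> carrier N)"
  interpret F: comm_group ?F by (rule comm_group_free_Abelian_group)
  have "subgroup (tensor_kernel M N) ?F"
    unfolding tensor_kernel_def
    by (rule F.generate_is_subgroup [OF tensor_relators_subset [OF assms]])
  then show ?thesis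
    unfolding tensor_product_def by (rule F.abelian_FactGroup)
qed

lemma bilinear_pure_tensor:
  assumes "comm_group M" "comm_group N"
  shows "bilinear_map M N (tensor_product M N) (pure_tensor M N)"
proof -
  let ?F = "free_Abelian_group (carrier M \<times> carrier N)"
  let ?K = "tensor_kernel M N"
  interpret M: comm_group M by fact
  interpret N: comm_group N by fact
  interpret F: comm_group ?F by (rule comm_group_free_Abelian_group)
  have sub: "subgroup ?K ?F"
    unfolding tensor_kernel_def
    by (rule F.generate_is_subgroup [OF tensor_relators_subset [OF assms]])
  then interpret K: normal ?K ?F by (rule F.subgroup_imp_normal)
  have car: "frag_of (m, n) \<in> carrier ?F" if "m \<in> carrier M" "n \<in> carrier N" for m n
    using that by (simp add: free_Abelian_group_def)
  have rel: "?K #>\<^bsub>?F\<^esub> x = ?K #>\<^bsub>?F\<^esub> (y \<otimes>\<^bsub>?F\<^esub> z)"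
    if "x - y - z \<in> tensor_relators M N" "x \<in> carrier ?F" "y \<in> carrier ?F" "z \<in> carrier ?F" for x y z
  proof -
    have "x - y - z \<in> ?K"
      unfolding tensor_kernel_def by (rule generate.incl [OF that(1)])
    moreover have "x = (x - y - z) \<otimes>\<^bsub>?F\<^esub> (y \<otimes>\<^bsub>?F\<^esub> z)"
      by (simp add: free_Abelian_group_def)
    ultimately have "x \<in> ?K #>\<^bsub>?F\<^esub> (y \<otimes>\<^bsub>?F\<^esub> z)"
      unfolding r_coset_def by blast
    then show ?thesis
      by (rule F.repr_independence [OF _ F.m_closed [OF that(3,4)] sub, THEN sym])
  qed
  show ?thesis
    unfolding bilinear_map_def
  proof (intro conjI ballI)
    fix m n assume "m \<in> carrier M" "n \<in> carrier N"
    then show "pure_tensor M N m n \<in> carrier (tensor_product M N)"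
      using car by (auto simp: pure_tensor_def tensor_product_def FactGroup_def RCOSETS_def)
  next
    fix m m' n assume *: "m \<in> carrier M" "m' \<in> carrier M" "n \<in> carrier N"
    then have "frag_of (m \<otimes>\<^bsub>M\<^esub> m', n) - frag_of (m, n) - frag_of (m', n) \<in> tensor_relators M N"
      unfolding tensor_relators_def by blast
    from rel [OF this] * show "pure_tensor M N (m \<otimes>\<^bsub>M\<^esub> m') n =
        pure_tensor M N m n \<otimes>\<^bsub>tensor_product M N\<^esub> pure_tensor M N m' n"
      by (simp add: pure_tensor_def tensor_product_def FactGroup_def K.rcos_sum car)
  next
    fix m n n' assume *: "m \<in> carrier M" "n \<in> carrier N" "n' \<in> carrier N"
    then have "frag_of (m, n \<otimes>\<^bsub>N\<^esub> n') - frag_of (m, n) - frag_of (m, n') \<in> tensor_relators M N"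
      unfolding tensor_relators_def by blast
    from rel [OF this] * show "pure_tensor M N m (n \<otimes>\<^bsub>N\<^esub> n') =
        pure_tensor M N m n \<otimes>\<^bsub>tensor_product M N\<^esub> pure_tensor M N m n'"
      by (simp add: pure_tensor_def tensor_product_def FactGroup_def K.rcos_sum car)
  qed
qed

lemma mult_U_group:
  assumes "comm_group M"
    and "m \<in> carrier M" "m' \<in> carrier M"
    and "t \<in> carrier (tensor_product M M)" "t' \<in> carrier (tensor_product M M)"
  shows "(1, m, t) \<otimes>\<^bsub>U_group M\<^esub> (1, m', t') =
    (1, m \<otimes>\<^bsub>M\<^esub> m',
     pure_tensor M M m m' \<otimes>\<^bsub>tensor_product M M\<^esub> t \<otimes>\<^bsub>tensor_product M M\<^esub> t')"
proof -
  interpret M: comm_group M by fact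
  interpret T: comm_group "tensor_product M M" using assms(1) by (intro comm_group_tensor_product)
  have "pure_tensor M M m m' \<in> carrier (tensor_product M M)"
    using bilinear_pure_tensor [OF assms(1,1)] assms by (simp add: bilinear_map_def)
  then show ?thesis
    using assms
    by (simp add: U_group_def units_of_def trunc_tensor_algebra_def Let_def M.m_comm T.m_ac)
qed

lemma carrier_U_group:
  assumes "comm_group M"
  shows "carrier (U_group M) = {1} \<times> carrier M \<times> carrier (tensor_product M M)"
proof -
  let ?T = "tensor_product M M"
  let ?p = "pure_tensor M M"
  interpret M: comm_group M by fact
  interpret T: comm_group ?T using assms by (intro comm_group_tensor_product)
  have p: "?p m n \<in> carrier ?T"
      "?p (m \<otimes>\<^bsub>M\<^esub> m') n = ?p m n \<otimes>\<^bsub>?T\<^esub> ?p m' n"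
      "?p m (n \<otimes>\<^bsub>M\<^esub> n') = ?p m n \<otimes>\<^bsub>?T\<^esub> ?p m n'"
    if "m \<in> carrier M" "m' \<in> carrier M" "n \<in> carrier M" "n' \<in> carrier M" for m m' n n'
    using bilinear_pure_tensor [OF assms assms] that by (simp_all add: bilinear_map_def)
  have p0: "?p \<one>\<^bsub>M\<^esub> n = \<one>\<^bsub>?T\<^esub>" "?p n \<one>\<^bsub>M\<^esub> = \<one>\<^bsub>?T\<^esub>" if "n \<in> carrier M" for n
    using p(2) [of "\<one>\<^bsub>M\<^esub>" "\<one>\<^bsub>M\<^esub>" n n] p(3) [of n n "\<one>\<^bsub>M\<^esub>" "\<one>\<^bsub>M\<^esub>"] that
    by (simp_all add: p(1) [OF that M.one_closed M.one_closed that]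
          p(1) [OF M.one_closed that that that] p(1) [OF that that M.one_closed that])
  have mult: "(1, m, t) \<otimes>\<^bsub>trunc_tensor_algebra M\<^esub> (1, m', t') =
      (1, m \<otimes>\<^bsub>M\<^esub> m', ?p m m' \<otimes>\<^bsub>?T\<^esub> t \<otimes>\<^bsub>?T\<^esub> t')"
    if "m \<in> carrier M" "m' \<in> carrier M" "t \<in> carrier ?T" "t' \<in> carrier ?T" for m m' t t'
    using mult_U_group [OF assms that] by (simp add: U_group_def units_of_def)
  have unit: "(1, m, t) \<in> Units (trunc_tensor_algebra M)"
    if mt: "m \<in> carrier M" "t \<in> carrier ?T" for m t
  proof -
    let ?i = "(1, inv\<^bsub>M\<^esub> m, ?p m m \<otimes>\<^bsub>?T\<^esub> inv\<^bsub>?T\<^esub> t) :: int \<times> 'a \<times> _"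
    have 1: "?p m (inv\<^bsub>M\<^esub> m) \<otimes>\<^bsub>?T\<^esub> ?p m m = \<one>\<^bsub>?T\<^esub>"
      using p(3) [of m m "inv\<^bsub>M\<^esub> m" m] mt p0 by simp
    have 2: "?p (inv\<^bsub>M\<^esub> m) m \<otimes>\<^bsub>?T\<^esub> ?p m m = \<one>\<^bsub>?T\<^esub>"
      using p(2) [of "inv\<^bsub>M\<^esub> m" m m m] mt p0 by simp
    have c: "?p m (inv\<^bsub>M\<^esub> m) \<in> carrier ?T" "?p (inv\<^bsub>M\<^esub> m) m \<in> carrier ?T" "?p m m \<in> carrier ?T"
      using p(1) mt by blast+
    have one: "\<one>\<^bsub>trunc_tensor_algebra M\<^esub> = (1, \<one>\<^bsub>M\<^esub>, \<one>\<^bsub>?T\<^esub>)"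
      by (simp add: trunc_tensor_algebra_def Let_def)
    have "?p m (inv\<^bsub>M\<^esub> m) \<otimes>\<^bsub>?T\<^esub> t \<otimes>\<^bsub>?T\<^esub> (?p m m \<otimes>\<^bsub>?T\<^esub> inv\<^bsub>?T\<^esub> t)
        = (?p m (inv\<^bsub>M\<^esub> m) \<otimes>\<^bsub>?T\<^esub> ?p m m) \<otimes>\<^bsub>?T\<^esub> (t \<otimes>\<^bsub>?T\<^esub> inv\<^bsub>?T\<^esub> t)"
      using c mt by (simp add: T.m_assoc T.m_lcomm [of t "?p m m"])
    then have "(1, m, t) \<otimes>\<^bsub>trunc_tensor_algebra M\<^esub> ?i = \<one>\<^bsub>trunc_tensor_algebra M\<^esub>"
      using c mt 1 by (simp add: mult one)
    moreover
    have "?p (inv\<^bsub>M\<^esub> m) m \<otimes>\<^bsub>?T\<^esub> (?p m m \<otimes>\<^bsub>?T\<^esub> inv\<^bsub>?T\<^esub> t) \<otimes>\<^bsub>?T\<^esub> t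
        = (?p (inv\<^bsub>M\<^esub> m) m \<otimes>\<^bsub>?T\<^esub> ?p m m) \<otimes>\<^bsub>?T\<^esub> (inv\<^bsub>?T\<^esub> t \<otimes>\<^bsub>?T\<^esub> t)"
      using c mt by (simp add: T.m_assoc)
    then have "?i \<otimes>\<^bsub>trunc_tensor_algebra M\<^esub> (1, m, t) = \<one>\<^bsub>trunc_tensor_algebra M\<^esub>"
      using c mt 2 by (simp add: mult one)
    moreover have "?i \<in> carrier (trunc_tensor_algebra M)" "(1, m, t) \<in> carrier (trunc_tensor_algebra M)"
      using c mt by (simp_all add: trunc_tensor_algebra_def Let_def)
    ultimately show ?thesis
      unfolding Units_def by blast
  qed
  show ?thesis
  proof
    show "carrier (U_group M) \<subseteq> {1} \<times> carrier M \<times> carrier ?T"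
      by (auto simp: U_group_def kernel_def units_of_def Units_def trunc_tensor_algebra_def Let_def)
    show "{1} \<times> carrier M \<times> carrier ?T \<subseteq> carrier (U_group M)"
      using unit by (auto simp: U_group_def kernel_def units_of_def)
  qed
qed

end

theory Submission
  imports Defs
begin

text \<open>
  In \<open>UM\<close> one has \<open>s(m) s(m') = s(m + m') (1 + m \<otimes> m')\<close>, so in any abelian quotient
  \<open>s(m + m') - s(m) - s(m')\<close> is the negative of the image of \<open>m \<otimes> m'\<close>; this gives
  quadraticity and shows that \<open>UM\<close> is generated by the image of \<open>s\<close>, which gives uniqueness.
  Conversely, if \<open>q\<close> is quadratic and \<open>B : M \<otimes> M \<rightarrow> G\<close> is the homomorphism induced by its
  polarization, then \<open>1 + m + t \<mapsto> q(m) - B(t)\<close> is a homomorphism on \<open>UM\<close>.  If \<open>2q = 0\<close>, the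
  homomorphism on \<open>(UM)\<^sup>a\<^sup>b\<close> is killed by \<open>2\<close> on generators, hence everywhere, and so
  factors through the tensor product with the field of two elements.
\<close>

section \<open>Homomorphisms and unique factorization\<close>

lemma group_homI:
  assumes "group G" "group H" "h \<in> hom G H"
  shows "group_hom G H h"
  using assms by (simp add: group_hom_def group_hom_axioms_def)

text \<open>Separates existence from uniqueness. The factoring map \<open>f\<close> may take any
  values off \<open>carrier A\<close>; restricting it gives the extensional representative.
  Uniqueness is asked in the form of an agreement principle for two homomorphisms, which is how the
  generation lemmas below are stated.\<close>

lemma factors_uniquelyI:
  assumes "group A"
    and f: "f \<in> hom A G" "\<And>m. m \<in> carrier M \<Longrightarrow> f (u m) = q m"
    and u: "u \<in> carrier M \<rightarrow> carrier A"
    and eq: "\<And>g h a. \<lbrakk>g \<in> hom A G; h \<in> hom A G; \<And>m. m \<in> carrier M \<Longrightarrow> g (u m) = h (u m);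
               a \<in> carrier A\<rbrakk> \<Longrightarrow> g a = h a"
  shows "factors_uniquely M A u G q"
  unfolding factors_uniquely_def
proof (rule ex1I [of _ "restrict f (carrier A)"])
  interpret A: group A by fact
  show "restrict f (carrier A) \<in> hom A G \<inter> extensional (carrier A) \<and>
      (\<forall>m\<in>carrier M. restrict f (carrier A) (u m) = q m)"
    using f u by (auto simp: hom_def Pi_iff)
next
  fix g assume g: "g \<in> hom A G \<inter> extensional (carrier A) \<and> (\<forall>m\<in>carrier M. g (u m) = q m)"
  show "g = restrict f (carrier A)"
  proof (rule extensionalityI [of _ "carrier A"])
    fix a assume "a \<in> carrier A"
    then show "g a = restrict f (carrier A) a"
      using eq [of g f a] f g by simp
  qed (use g in auto)
qed

text \<open>Makes "killed by 2" an equality of two homomorphisms, doubled \<open>f\<close> and the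
  trivial one, so that it can be checked on generators.\<close>

lemma hom_pow2:
  assumes "comm_group G" "f \<in> hom A G"
  shows "(\<lambda>a. f a [^]\<^bsub>G\<^esub> (2::nat)) \<in> hom A G"
proof -
  interpret G: comm_group G by fact
  show ?thesis
    using assms(2) by (auto simp: hom_def Pi_iff G.nat_pow_distrib)
qed

section \<open>Bilinear and quadratic maps\<close>

lemma bilinear_map_hom_left:
  "bilinear_map M N G b \<Longrightarrow> n \<in> carrier N \<Longrightarrow> (\<lambda>m. b m n) \<in> hom M G"
  by (auto simp: bilinear_map_def hom_def)

lemma bilinear_map_hom_right:
  "bilinear_map M N G b \<Longrightarrow> m \<in> carrier M \<Longrightarrow> b m \<in> hom N G"
  by (auto simp: bilinear_map_def hom_def)

lemma bilinear_map_compose_hom: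
  assumes "bilinear_map M N G b" "f \<in> hom G H"
  shows "bilinear_map M N H (\<lambda>m n. f (b m n))"
  using assms unfolding bilinear_map_def by (auto simp: hom_mult hom_in_carrier)

text \<open>The axioms also evaluate the maps at products of arguments, which stay in the carriers
  because these are closed.\<close>

lemma bilinear_map_cong:
  assumes "comm_group M" "comm_group N"
    and "\<And>m n. m \<in> carrier M \<Longrightarrow> n \<in> carrier N \<Longrightarrow> b m n = c m n"
  shows "bilinear_map M N G b \<longleftrightarrow> bilinear_map M N G c"
proof -
  interpret M: comm_group M by fact
  interpret N: comm_group N by fact
  show ?thesis
    using assms(3) by (simp add: bilinear_map_def)
qed

text \<open>A homomorphism carries the polarization of \<open>q\<close> to the polarization of the
  composite.\<close>

lemma quadratic_map_compose_hom:
  assumes q: "quadratic_map M G q" and "comm_group H" and f: "f \<in> hom G H"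
  shows "quadratic_map M H (\<lambda>m. f (q m))"
proof -
  interpret M: comm_group M using q by (simp add: quadratic_map_def)
  interpret G: comm_group G using q by (simp add: quadratic_map_def)
  interpret H: comm_group H by fact
  interpret f: group_hom G H f using f by (intro group_homI) auto
  have q_car: "q m \<in> carrier G" if "m \<in> carrier M" for m
    using q that by (auto simp: quadratic_map_def)
  have "bilinear_map M M H
      (\<lambda>m m'. f (q (m \<otimes>\<^bsub>M\<^esub> m') \<otimes>\<^bsub>G\<^esub> inv\<^bsub>G\<^esub> q m \<otimes>\<^bsub>G\<^esub> inv\<^bsub>G\<^esub> q m'))"
    by (rule bilinear_map_compose_hom [OF _ f]) (use q in \<open>simp add: quadratic_map_def\<close>)
  also have "?this \<longleftrightarrow> bilinear_map M M H
      (\<lambda>m m'. f (q (m \<otimes>\<^bsub>M\<^esub> m')) \<otimes>\<^bsub>H\<^esub> inv\<^bsub>H\<^esub> f (q m) \<otimes>\<^bsub>H\<^esub> inv\<^bsub>H\<^esub> f (q m'))"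
    by (rule bilinear_map_cong) (simp_all add: q_car M.comm_group_axioms)
  finally show ?thesis
    using q_car by (simp add: quadratic_map_def M.comm_group_axioms H.comm_group_axioms)
qed

section \<open>Universal property of the tensor product\<close>

lemma normal_tensor_kernel:
  assumes "comm_group M" "comm_group N"
  shows "tensor_kernel M N \<lhd> free_Abelian_group (carrier M \<times> carrier N)"
proof -
  interpret F: comm_group "free_Abelian_group (carrier M \<times> carrier N)"
    by (rule comm_group_free_Abelian_group)
  show ?thesis
    unfolding tensor_kernel_def
    by (rule F.subgroup_imp_normal [OF F.generate_is_subgroup [OF tensor_relators_subset [OF assms]]])
qed

lemma pure_tensor_closed:
  assumes "comm_group M" "comm_group N" "m \<in> carrier M" "n \<in> carrier N"
  shows "pure_tensor M N m n \<in> carrier (tensor_product M N)"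
  using bilinear_pure_tensor [OF assms(1,2)] assms(3,4) by (simp add: bilinear_map_def)

lemma pure_tensor_one:
  assumes "comm_group M" "comm_group N"
  shows "m \<in> carrier M \<Longrightarrow> pure_tensor M N m \<one>\<^bsub>N\<^esub> = \<one>\<^bsub>tensor_product M N\<^esub>"
    and "n \<in> carrier N \<Longrightarrow> pure_tensor M N \<one>\<^bsub>M\<^esub> n = \<one>\<^bsub>tensor_product M N\<^esub>"
proof -
  interpret M: comm_group M by fact
  interpret N: comm_group N by fact
  interpret T: comm_group "tensor_product M N" using assms by (rule comm_group_tensor_product)
  note b = bilinear_pure_tensor [OF assms]
  show "pure_tensor M N m \<one>\<^bsub>N\<^esub> = \<one>\<^bsub>tensor_product M N\<^esub>" if "m \<in> carrier M"
    by (rule hom_one [OF bilinear_map_hom_right [OF b that]]) auto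
  show "pure_tensor M N \<one>\<^bsub>M\<^esub> n = \<one>\<^bsub>tensor_product M N\<^esub>" if "n \<in> carrier N"
    by (rule hom_one [OF bilinear_map_hom_left [OF b that]]) auto
qed

text \<open>Extend \<open>b\<close> linearly to the free abelian group; bilinearity says exactly
  that the relators die, so the extension descends to the quotient.\<close>

lemma tensor_product_universal:
  assumes "comm_group M" "comm_group N" "comm_group G" and b: "bilinear_map M N G b"
  obtains h where "h \<in> hom (tensor_product M N) G"
    "\<And>m n. m \<in> carrier M \<Longrightarrow> n \<in> carrier N \<Longrightarrow> h (pure_tensor M N m n) = b m n"
proof -
  let ?F = "free_Abelian_group (carrier M \<times> carrier N)"
  interpret M: comm_group M by fact
  interpret N: comm_group N by fact
  interpret G: comm_group G by fact
  interpret F: comm_group ?F by (rule comm_group_free_Abelian_group)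
  have b_car: "b m n \<in> carrier G" if "m \<in> carrier M" "n \<in> carrier N" for m n
    using b that by (simp add: bilinear_map_def)
  obtain h where h: "h \<in> hom ?F G" "\<And>x. x \<in> carrier M \<times> carrier N \<Longrightarrow> h (frag_of x) = case_prod b x"
    by (rule G.free_Abelian_group_universal [of "case_prod b" "carrier M \<times> carrier N"])
      (use b_car in auto)
  interpret h: group_hom ?F G h using h(1) by (intro group_homI) auto
  have diff: "h (x - y - z) = h x \<otimes>\<^bsub>G\<^esub> inv\<^bsub>G\<^esub> h y \<otimes>\<^bsub>G\<^esub> inv\<^bsub>G\<^esub> h z"
    if "x \<in> carrier ?F" "y \<in> carrier ?F" "z \<in> carrier ?F" for x y z
  proof -
    \<comment> \<open>The relators use the subtraction of finitely supported functions; the laws for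
      \<open>h\<close> need it in terms of the group operations.\<close>
    have "x - y - z = x \<otimes>\<^bsub>?F\<^esub> inv\<^bsub>?F\<^esub> y \<otimes>\<^bsub>?F\<^esub> inv\<^bsub>?F\<^esub> z"
      using that by simp
    then show ?thesis
      using that by (simp only: h.hom_mult h.hom_inv F.m_closed F.inv_closed)
  qed
  \<comment> \<open>The value of \<open>h\<close> on a relator takes this form once bilinearity has
    split its first term.\<close>
  have cancel: "x \<otimes>\<^bsub>G\<^esub> y \<otimes>\<^bsub>G\<^esub> inv\<^bsub>G\<^esub> x \<otimes>\<^bsub>G\<^esub> inv\<^bsub>G\<^esub> y = \<one>\<^bsub>G\<^esub>"
    if "x \<in> carrier G" "y \<in> carrier G" for x y
    using that by (simp add: G.m_comm [of x y] G.m_assoc)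
  have "tensor_relators M N \<subseteq> kernel ?F G h"
  proof
    fix x assume x: "x \<in> tensor_relators M N"
    then have "x \<in> carrier ?F"
      using tensor_relators_subset [OF assms(1,2)] by blast
    moreover have "h x = \<one>\<^bsub>G\<^esub>"
      using x b unfolding tensor_relators_def
      by (auto simp: diff h(2) bilinear_map_def cancel)
    ultimately show "x \<in> kernel ?F G h"
      by (simp add: kernel_def)
  qed
  then have "tensor_kernel M N \<subseteq> kernel ?F G h"
    unfolding tensor_kernel_def by (rule F.generate_subgroup_incl [OF _ h.subgroup_kernel])
  then obtain g where g: "g \<in> hom (?F Mod tensor_kernel M N) G"
      "\<And>x. x \<in> carrier ?F \<Longrightarrow> g (tensor_kernel M N #>\<^bsub>?F\<^esub> x) = h x"
    using h.FactGroup_universal_kernel [OF normal_tensor_kernel [OF assms(1,2)]] by blast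
  show thesis
  proof
    show "g \<in> hom (tensor_product M N) G"
      using g(1) by (simp add: tensor_product_def)
    show "g (pure_tensor M N m n) = b m n" if "m \<in> carrier M" "n \<in> carrier N" for m n
      using that by (simp add: pure_tensor_def g(2) h(2))
  qed
qed

text \<open>Pure tensors generate: both maps are pulled back to the free abelian group and compared
  by induction over differences of basis elements.\<close>

lemma tensor_product_hom_eqI:
  assumes "comm_group M" "comm_group N" "group G"
    and f: "f \<in> hom (tensor_product M N) G" and g: "g \<in> hom (tensor_product M N) G"
    and eq: "\<And>m n. m \<in> carrier M \<Longrightarrow> n \<in> carrier N \<Longrightarrow>
      f (pure_tensor M N m n) = g (pure_tensor M N m n)"
    and t: "t \<in> carrier (tensor_product M N)"
  shows "f t = g t"
proof -
  let ?F = "free_Abelian_group (carrier M \<times> carrier N)"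
  let ?\<pi> = "\<lambda>x. tensor_kernel M N #>\<^bsub>?F\<^esub> x"
  interpret G: group G by fact
  interpret F: comm_group ?F by (rule comm_group_free_Abelian_group)
  have \<pi>: "?\<pi> \<in> hom ?F (tensor_product M N)"
    using normal.r_coset_hom_Mod [OF normal_tensor_kernel [OF assms(1,2)]]
    by (simp add: tensor_product_def)
  interpret f: group_hom ?F G "\<lambda>x. f (?\<pi> x)"
    using hom_compose [OF \<pi> f] by (intro group_homI) (auto simp: o_def)
  interpret g: group_hom ?F G "\<lambda>x. g (?\<pi> x)"
    using hom_compose [OF \<pi> g] by (intro group_homI) (auto simp: o_def)
  obtain x where x: "Poly_Mapping.keys x \<subseteq> carrier M \<times> carrier N" "t = ?\<pi> x"
    using t by (auto simp: tensor_product_def carrier_FactGroup)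
  from x(1) have "f (?\<pi> x) = g (?\<pi> x)"
  proof (induction x rule: free_Abelian_group_induct [consumes 1, case_names zero diff frag_of])
    case zero
    show ?case using f.hom_one g.hom_one by simp
  next
    case (diff x y)
    then have xy: "x \<in> carrier ?F" "y \<in> carrier ?F" and "x - y = x \<otimes>\<^bsub>?F\<^esub> inv\<^bsub>?F\<^esub> y"
      by simp_all
    then show ?case
      using diff(3,4) by (simp only: f.hom_mult g.hom_mult f.hom_inv g.hom_inv F.inv_closed)
  next
    case (frag_of a)
    then show ?case using eq by (auto simp: pure_tensor_def)
  qed
  with x(2) show ?thesis by simp
qed

section \<open>Abelianization\<close>

lemma comm_group_abelianization: "group G \<Longrightarrow> comm_group (abelianization G)"
  unfolding abelianization_def by (rule group.derived_quot_is_comm_group)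

lemma abelianization_map_hom:
  "group G \<Longrightarrow> abelianization_map G \<in> hom G (abelianization G)"
  using normal.r_coset_hom_Mod [OF group.derived_self_is_normal, of G]
  by (simp add: abelianization_def abelianization_map_def [abs_def])

lemma abelianization_map_surj:
  "carrier (abelianization G) = abelianization_map G ` carrier G"
  by (auto simp: abelianization_def abelianization_map_def carrier_FactGroup)

text \<open>The image of the derived subgroup is the derived subgroup of the image, which is trivial
  in a commutative group.\<close>

lemma abelianization_universal:
  assumes "group G" "comm_group H" "f \<in> hom G H"
  obtains g where "g \<in> hom (abelianization G) H"
    "\<And>x. x \<in> carrier G \<Longrightarrow> g (abelianization_map G x) = f x"
proof -
  interpret G: group G by fact
  interpret H: comm_group H by fact
  interpret f: group_hom G H f using assms by (intro group_homI) auto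
  have "f ` derived G (carrier G) = {\<one>\<^bsub>H\<^esub>}"
    using f.derived_img [of "carrier G"] H.derived_eq_singleton [of "f ` carrier G"] by force
  moreover have "derived G (carrier G) \<subseteq> carrier G"
    by (rule G.derived_in_carrier) simp
  ultimately have "derived G (carrier G) \<subseteq> kernel G H f"
    by (auto simp: kernel_def)
  then show thesis
    using f.FactGroup_universal_kernel [OF G.derived_self_is_normal] that
    by (metis abelianization_def abelianization_map_def)
qed

section \<open>The group of unipotent units\<close>

lemma one_U_group: "\<one>\<^bsub>U_group M\<^esub> = (1, \<one>\<^bsub>M\<^esub>, \<one>\<^bsub>tensor_product M M\<^esub>)"
  by (simp add: U_group_def units_of_def trunc_tensor_algebra_def Let_def)

text \<open>The axioms are checked on components. In degree 2, associativity comes down to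
  biadditivity of the pure tensor.\<close>

lemma group_U_group:
  assumes "comm_group M"
  shows "group (U_group M)"
proof -
  let ?T = "tensor_product M M"
  let ?p = "pure_tensor M M"
  interpret M: comm_group M by fact
  interpret T: comm_group ?T using assms by (intro comm_group_tensor_product)
  note p [simp] = pure_tensor_closed [OF assms assms] pure_tensor_one [OF assms assms]
  have p2: "?p (m \<otimes>\<^bsub>M\<^esub> m') n = ?p m n \<otimes>\<^bsub>?T\<^esub> ?p m' n"
      "?p n (m \<otimes>\<^bsub>M\<^esub> m') = ?p n m \<otimes>\<^bsub>?T\<^esub> ?p n m'"
    if "m \<in> carrier M" "m' \<in> carrier M" "n \<in> carrier M" for m m' n
    using bilinear_pure_tensor [OF assms assms] that by (simp_all add: bilinear_map_def)
  show ?thesis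
  proof (rule groupI)
    fix x assume "x \<in> carrier (U_group M)"
    then obtain m t where x: "x = (1, m, t)" and mt: "m \<in> carrier M" "t \<in> carrier ?T"
      by (auto simp: carrier_U_group [OF assms])
    \<comment> \<open>The degree 2 part of \<open>?y\<close> times \<open>x\<close> is the tensor of
      -m with m, plus the unknown component, plus \<open>t\<close>; it vanishes for this
      choice.\<close>
    let ?y = "(1, inv\<^bsub>M\<^esub> m, inv\<^bsub>?T\<^esub> (?p (inv\<^bsub>M\<^esub> m) m \<otimes>\<^bsub>?T\<^esub> t))"
    have "?y \<otimes>\<^bsub>U_group M\<^esub> x = \<one>\<^bsub>U_group M\<^esub>"
      using mt by (simp add: x mult_U_group [OF assms] one_U_group T.inv_mult T.m_ac)
    moreover have "?y \<in> carrier (U_group M)"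
      using mt by (simp add: carrier_U_group [OF assms])
    ultimately show "\<exists>y\<in>carrier (U_group M). y \<otimes>\<^bsub>U_group M\<^esub> x = \<one>\<^bsub>U_group M\<^esub>"
      by blast
  qed (auto simp: carrier_U_group [OF assms] mult_U_group [OF assms] one_U_group p2 M.m_assoc T.m_ac)
qed

lemma U_embed_closed:
  assumes "comm_group M" "m \<in> carrier M"
  shows "U_embed M m \<in> carrier (U_group M)"
proof -
  interpret T: comm_group "tensor_product M M" using assms(1) by (intro comm_group_tensor_product)
  show ?thesis using assms by (simp add: carrier_U_group U_embed_def)
qed

text \<open>Elements 1 + t multiply by adding their degree 2 parts, since the tensor of 0 with 0
  vanishes.\<close>

lemma U_tensor_hom:
  assumes "comm_group M"
  shows "(\<lambda>t. (1, \<one>\<^bsub>M\<^esub>, t)) \<in> hom (tensor_product M M) (U_group M)"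
proof -
  interpret M: comm_group M by fact
  interpret T: comm_group "tensor_product M M" using assms by (intro comm_group_tensor_product)
  show ?thesis
    by (auto simp: hom_def carrier_U_group [OF assms] mult_U_group [OF assms]
        pure_tensor_one [OF assms assms])
qed

lemma U_embed_mult_tensor:
  assumes "comm_group M" "m \<in> carrier M" "t \<in> carrier (tensor_product M M)"
  shows "U_embed M m \<otimes>\<^bsub>U_group M\<^esub> (1, \<one>\<^bsub>M\<^esub>, t) = (1, m, t)"
proof -
  interpret M: comm_group M by fact
  interpret T: comm_group "tensor_product M M" using assms(1) by (intro comm_group_tensor_product)
  show ?thesis
    using assms by (simp add: U_embed_def mult_U_group pure_tensor_one)
qed

text \<open>Measures how far s is from being a homomorphism. Both sides have components m + m' and
  the pure tensor of m and m'.\<close>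

lemma U_embed_mult:
  assumes "comm_group M" "m \<in> carrier M" "m' \<in> carrier M"
  shows "U_embed M m \<otimes>\<^bsub>U_group M\<^esub> U_embed M m' =
    U_embed M (m \<otimes>\<^bsub>M\<^esub> m') \<otimes>\<^bsub>U_group M\<^esub> (1, \<one>\<^bsub>M\<^esub>, pure_tensor M M m m')"
proof -
  interpret M: comm_group M by fact
  interpret T: comm_group "tensor_product M M" using assms(1) by (intro comm_group_tensor_product)
  show ?thesis
    using assms pure_tensor_closed [OF assms(1,1,2,3)]
    by (simp add: U_embed_mult_tensor) (simp add: U_embed_def mult_U_group)
qed

text \<open>This says that s(M) generates UM: the elements 1 + t with t a pure tensor come from
  values of s by \<open>U_embed_mult\<close>, these give all 1 + t, and 1 + m + t = s(m)(1 +
  t).\<close>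

lemma U_group_hom_eqI:
  assumes "comm_group M" "group G"
    and f: "f \<in> hom (U_group M) G" and g: "g \<in> hom (U_group M) G"
    and eq: "\<And>m. m \<in> carrier M \<Longrightarrow> f (U_embed M m) = g (U_embed M m)"
    and x: "x \<in> carrier (U_group M)"
  shows "f x = g x"
proof -
  let ?T = "tensor_product M M"
  let ?j = "\<lambda>t. (1, \<one>\<^bsub>M\<^esub>, t)"
  interpret M: comm_group M by fact
  interpret G: group G by fact
  interpret T: comm_group ?T using assms(1) by (intro comm_group_tensor_product)
  note j = U_tensor_hom [OF assms(1)]
  note closed = U_embed_closed [OF assms(1)] hom_in_carrier [OF j]
  have eq_t: "f (?j t) = g (?j t)" if t: "t \<in> carrier ?T" for t
  proof (rule tensor_product_hom_eqI [OF assms(1,1,2) _ _ _ t])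
    show "(\<lambda>t. f (?j t)) \<in> hom ?T G" "(\<lambda>t. g (?j t)) \<in> hom ?T G"
      using hom_compose [OF j f] hom_compose [OF j g] by (simp_all add: o_def)
    fix m m' assume m: "m \<in> carrier M" "m' \<in> carrier M"
    note p = pure_tensor_closed [OF assms(1,1) m]
    let ?x = "U_embed M (m \<otimes>\<^bsub>M\<^esub> m')"
    \<comment> \<open>As \<open>f\<close> and \<open>g\<close> agree at \<open>?x\<close>, that
      factor can be cancelled on the left; \<open>G\<close> need not be commutative.\<close>
    have "f ?x \<otimes>\<^bsub>G\<^esub> f (?j (pure_tensor M M m m')) = f (U_embed M m) \<otimes>\<^bsub>G\<^esub> f (U_embed M m')"
      using m p by (simp add: closed U_embed_mult [OF assms(1)] flip: hom_mult [OF f])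
    also have "\<dots> = g (U_embed M m) \<otimes>\<^bsub>G\<^esub> g (U_embed M m')"
      using m by (simp add: eq)
    also have "\<dots> = g ?x \<otimes>\<^bsub>G\<^esub> g (?j (pure_tensor M M m m'))"
      using m p by (simp add: closed U_embed_mult [OF assms(1)] flip: hom_mult [OF g])
    also have "g ?x = f ?x"
      using m by (simp add: eq)
    finally show "f (?j (pure_tensor M M m m')) = g (?j (pure_tensor M M m m'))"
      using m p closed hom_in_carrier [OF f] hom_in_carrier [OF g] by simp
  qed
  obtain m t where mt: "x = (1, m, t)" "m \<in> carrier M" "t \<in> carrier ?T"
    using x by (auto simp: carrier_U_group [OF assms(1)])
  then have "x = U_embed M m \<otimes>\<^bsub>U_group M\<^esub> ?j t"
    by (simp add: U_embed_mult_tensor [OF assms(1)])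
  then show ?thesis
    using mt closed by (simp add: hom_mult [OF f] hom_mult [OF g] eq eq_t)
qed

text \<open>The minus sign in front of B is forced: multiplicativity at s(m) and s(m') requires q(m
  + m') - B to equal q(m) + q(m') when B is taken at the tensor of m and m'.\<close>

lemma quadratic_map_lift_U_group:
  assumes q: "quadratic_map M G q"
  obtains f where "f \<in> hom (U_group M) G" "\<And>m. m \<in> carrier M \<Longrightarrow> f (U_embed M m) = q m"
proof -
  let ?T = "tensor_product M M"
  have M: "comm_group M" and G: "comm_group G"
    using q by (simp_all add: quadratic_map_def)
  interpret M: comm_group M by fact
  interpret G: comm_group G by fact
  interpret T: comm_group ?T using M by (intro comm_group_tensor_product)
  have q_car: "q m \<in> carrier G" if "m \<in> carrier M" for m
    using q that by (auto simp: quadratic_map_def)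
  obtain B where B: "B \<in> hom ?T G"
    and B_pure: "\<And>m m'. m \<in> carrier M \<Longrightarrow> m' \<in> carrier M \<Longrightarrow>
      B (pure_tensor M M m m') = q (m \<otimes>\<^bsub>M\<^esub> m') \<otimes>\<^bsub>G\<^esub> inv\<^bsub>G\<^esub> q m \<otimes>\<^bsub>G\<^esub> inv\<^bsub>G\<^esub> q m'"
    using q tensor_product_universal [OF M M G] unfolding quadratic_map_def by blast
  interpret B: group_hom ?T G B using B by (intro group_homI) auto
  let ?f = "\<lambda>(k::int, m, t). q m \<otimes>\<^bsub>G\<^esub> inv\<^bsub>G\<^esub> B t"
  show thesis
  proof
    have "q (m \<otimes>\<^bsub>M\<^esub> m') \<otimes>\<^bsub>G\<^esub> inv\<^bsub>G\<^esub> B (pure_tensor M M m m' \<otimes>\<^bsub>?T\<^esub> t \<otimes>\<^bsub>?T\<^esub> t') =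
        q m \<otimes>\<^bsub>G\<^esub> inv\<^bsub>G\<^esub> B t \<otimes>\<^bsub>G\<^esub> (q m' \<otimes>\<^bsub>G\<^esub> inv\<^bsub>G\<^esub> B t')"
      if m: "m \<in> carrier M" "m' \<in> carrier M" and t: "t \<in> carrier ?T" "t' \<in> carrier ?T" for m m' t t'
    proof -
      \<comment> \<open>Expanding B at the pure tensor produces the inverse of q(m + m'). The
        cancelling pair is written out on the right, and the inverse laws are withheld, so that both
        sides agree up to reordering.\<close>
      have "q (m \<otimes>\<^bsub>M\<^esub> m') \<otimes>\<^bsub>G\<^esub> inv\<^bsub>G\<^esub> B (pure_tensor M M m m' \<otimes>\<^bsub>?T\<^esub> t \<otimes>\<^bsub>?T\<^esub> t') =
          (q (m \<otimes>\<^bsub>M\<^esub> m') \<otimes>\<^bsub>G\<^esub> inv\<^bsub>G\<^esub> q (m \<otimes>\<^bsub>M\<^esub> m')) \<otimes>\<^bsub>G\<^esub>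
          (q m \<otimes>\<^bsub>G\<^esub> inv\<^bsub>G\<^esub> B t \<otimes>\<^bsub>G\<^esub> (q m' \<otimes>\<^bsub>G\<^esub> inv\<^bsub>G\<^esub> B t'))"
        using m t q_car pure_tensor_closed [OF M M m]
        by (simp add: B_pure G.inv_mult G.m_ac del: G.r_inv G.l_inv)
      then show ?thesis
        using m t q_car by simp
    qed
    then show "?f \<in> hom (U_group M) G"
      using q_car by (auto simp: hom_def carrier_U_group [OF M] mult_U_group [OF M])
    show "?f (U_embed M m) = q m" if "m \<in> carrier M" for m
      using that q_car by (simp add: U_embed_def)
  qed
qed

section \<open>The universal quadratic maps\<close>

lemma comm_group_U_ab: "comm_group M \<Longrightarrow> comm_group (U_ab M)"
  unfolding U_ab_def by (intro comm_group_abelianization group_U_group)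

text \<open>The projection onto the abelianization is surjective, so agreement can be tested on
  UM.\<close>

lemma U_ab_hom_eqI:
  assumes "comm_group M" "group G"
    and f: "f \<in> hom (U_ab M) G" and g: "g \<in> hom (U_ab M) G"
    and eq: "\<And>m. m \<in> carrier M \<Longrightarrow> f (U_ab_map M m) = g (U_ab_map M m)"
    and a: "a \<in> carrier (U_ab M)"
  shows "f a = g a"
proof -
  let ?\<pi> = "abelianization_map (U_group M)"
  have \<pi>: "?\<pi> \<in> hom (U_group M) (U_ab M)"
    using abelianization_map_hom [OF group_U_group [OF assms(1)]] by (simp add: U_ab_def)
  obtain x where x: "x \<in> carrier (U_group M)" "a = ?\<pi> x"
    using a by (auto simp: U_ab_def abelianization_map_surj)
  have "(f \<circ> ?\<pi>) x = (g \<circ> ?\<pi>) x"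
    using eq by (intro U_group_hom_eqI [OF assms(1,2) hom_compose [OF \<pi> f] hom_compose [OF \<pi> g] _ x(1)])
      (simp add: U_ab_map_def)
  with x show ?thesis by simp
qed

text \<open>The polarization is the pure tensor followed by the homomorphism \<open>?c\<close>,
  which sends t to the inverse of the class of 1 + t.\<close>

lemma quadratic_map_U_ab_map:
  assumes M: "comm_group M"
  shows "quadratic_map M (U_ab M) (U_ab_map M)"
proof -
  let ?T = "tensor_product M M"
  let ?U = "U_group M"
  let ?A = "U_ab M"
  let ?j = "\<lambda>t. (1, \<one>\<^bsub>M\<^esub>, t)"
  interpret M: comm_group M by fact
  interpret T: comm_group ?T using M by (intro comm_group_tensor_product)
  interpret U: group ?U using M by (rule group_U_group)
  interpret A: comm_group ?A using M by (rule comm_group_U_ab)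
  interpret \<pi>: group_hom ?U ?A "abelianization_map ?U"
    using abelianization_map_hom [OF U.group_axioms, folded U_ab_def] by (intro group_homI) auto
  interpret j: group_hom ?T ?U ?j
    using U_tensor_hom [OF M] by (intro group_homI) auto
  let ?c = "\<lambda>t. inv\<^bsub>?A\<^esub> abelianization_map ?U (?j t)"
  \<comment> \<open>Inversion is a homomorphism because the target is commutative.\<close>
  have c: "?c \<in> hom ?T ?A"
    by (rule homI) (simp_all add: A.inv_mult)
  have closed: "U_ab_map M m \<in> carrier ?A" if "m \<in> carrier M" for m
    using that by (simp add: U_ab_map_def U_embed_closed [OF M])
  have "bilinear_map M M ?A (\<lambda>m m'. ?c (pure_tensor M M m m'))"
    by (rule bilinear_map_compose_hom [OF bilinear_pure_tensor [OF M M] c])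
  also have "?this \<longleftrightarrow> bilinear_map M M ?A (\<lambda>m m'.
      U_ab_map M (m \<otimes>\<^bsub>M\<^esub> m') \<otimes>\<^bsub>?A\<^esub> inv\<^bsub>?A\<^esub> U_ab_map M m \<otimes>\<^bsub>?A\<^esub> inv\<^bsub>?A\<^esub> U_ab_map M m')"
  proof (rule bilinear_map_cong [OF M M])
    fix m m' assume m: "m \<in> carrier M" "m' \<in> carrier M"
    let ?y = "abelianization_map ?U (?j (pure_tensor M M m m'))"
    have y: "?y \<in> carrier ?A"
      by (simp add: pure_tensor_closed [OF M M m])
    have "U_ab_map M m \<otimes>\<^bsub>?A\<^esub> U_ab_map M m' = U_ab_map M (m \<otimes>\<^bsub>M\<^esub> m') \<otimes>\<^bsub>?A\<^esub> ?y"
      using m by (simp add: U_ab_map_def U_embed_closed [OF M] U_embed_mult [OF M]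
          pure_tensor_closed [OF M M] flip: \<pi>.hom_mult)
    then have "inv\<^bsub>?A\<^esub> U_ab_map M m \<otimes>\<^bsub>?A\<^esub> inv\<^bsub>?A\<^esub> U_ab_map M m' =
        inv\<^bsub>?A\<^esub> U_ab_map M (m \<otimes>\<^bsub>M\<^esub> m') \<otimes>\<^bsub>?A\<^esub> inv\<^bsub>?A\<^esub> ?y"
      using m y closed by (simp flip: A.inv_mult)
    then show "inv\<^bsub>?A\<^esub> ?y =
        U_ab_map M (m \<otimes>\<^bsub>M\<^esub> m') \<otimes>\<^bsub>?A\<^esub> inv\<^bsub>?A\<^esub> U_ab_map M m \<otimes>\<^bsub>?A\<^esub> inv\<^bsub>?A\<^esub> U_ab_map M m'"
      using m y closed by (simp add: A.m_assoc) (simp flip: A.m_assoc)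
  qed
  finally show ?thesis
    using closed by (simp add: quadratic_map_def M A.comm_group_axioms)
qed

lemma U_ab_universal:
  assumes "quadratic_map M G q"
  obtains f where "f \<in> hom (U_ab M) G" "\<And>m. m \<in> carrier M \<Longrightarrow> f (U_ab_map M m) = q m"
proof -
  have M: "comm_group M" and G: "comm_group G"
    using assms by (simp_all add: quadratic_map_def)
  obtain f where f: "f \<in> hom (U_group M) G" "\<And>m. m \<in> carrier M \<Longrightarrow> f (U_embed M m) = q m"
    using quadratic_map_lift_U_group [OF assms] by blast
  obtain g where g: "g \<in> hom (U_ab M) G"
      "\<And>x. x \<in> carrier (U_group M) \<Longrightarrow> g (abelianization_map (U_group M) x) = f x"
    using abelianization_universal [OF group_U_group [OF M] G f(1)] unfolding U_ab_def by blast
  show thesis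
    by (rule that [OF g(1)]) (simp add: U_ab_map_def g(2) f(2) U_embed_closed [OF M])
qed

section \<open>Tensoring with the field of two elements\<close>

lemma comm_group_tensor_F2: "comm_group A \<Longrightarrow> comm_group (tensor_F2 A)"
  by (simp add: tensor_F2_def comm_group_tensor_product)

lemma tensor_F2_map_hom:
  assumes "comm_group A"
  shows "tensor_F2_map A \<in> hom A (tensor_F2 A)"
  using bilinear_map_hom_left [OF bilinear_pure_tensor [OF assms abelian_integer_mod_group], of 1 2]
  by (simp add: tensor_F2_def tensor_F2_map_def [abs_def])

lemma carrier_integer_mod_group_2: "carrier (integer_mod_group 2) = {0, 1}"
  by (auto simp: carrier_integer_mod_group)

lemma tensor_F2_map_pow2:
  assumes "comm_group A" "a \<in> carrier A"
  shows "tensor_F2_map A a [^]\<^bsub>tensor_F2 A\<^esub> (2::nat) = \<one>\<^bsub>tensor_F2 A\<^esub>"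
proof -
  interpret T: comm_group "tensor_product A (integer_mod_group 2)"
    using assms by (simp add: comm_group_tensor_product)
  interpret p: group_hom "integer_mod_group 2" "tensor_product A (integer_mod_group 2)"
      "pure_tensor A (integer_mod_group 2) a"
    using bilinear_map_hom_right [OF bilinear_pure_tensor [OF assms(1) abelian_integer_mod_group] assms(2)]
    by (intro group_homI) auto
  show ?thesis
    \<comment> \<open>Doubling moves into the second slot, where 1 + 1 = 0 in
      \<open>integer_mod_group 2\<close>.\<close>
    using p.hom_nat_pow [of 1 2] p.hom_one by (simp add: tensor_F2_def tensor_F2_map_def)
qed

text \<open>A pure tensor has second entry 0, and is then trivial, or 1, and then lies in the image
  of \<open>tensor_F2_map\<close>.\<close>

lemma tensor_F2_hom_eqI:
  assumes "comm_group A" "group G"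
    and f: "f \<in> hom (tensor_F2 A) G" and g: "g \<in> hom (tensor_F2 A) G"
    and eq: "\<And>a. a \<in> carrier A \<Longrightarrow> f (tensor_F2_map A a) = g (tensor_F2_map A a)"
    and x: "x \<in> carrier (tensor_F2 A)"
  shows "f x = g x"
proof -
  let ?Z = "integer_mod_group 2"
  interpret G: group G by fact
  interpret T: comm_group "tensor_F2 A" using assms(1) by (rule comm_group_tensor_F2)
  have "f \<one>\<^bsub>tensor_F2 A\<^esub> = g \<one>\<^bsub>tensor_F2 A\<^esub>"
    using hom_one [OF f] hom_one [OF g] by simp
  then have "f (pure_tensor A ?Z a k) = g (pure_tensor A ?Z a k)"
    if "a \<in> carrier A" "k \<in> carrier ?Z" for a k
    using that eq pure_tensor_one(1) [OF assms(1) abelian_integer_mod_group, of a 2]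
    by (auto simp: carrier_integer_mod_group_2 tensor_F2_def tensor_F2_map_def)
  then show ?thesis
    using f g x tensor_product_hom_eqI [OF assms(1) abelian_integer_mod_group assms(2)]
    unfolding tensor_F2_def by blast
qed

lemma tensor_F2_universal:
  assumes "comm_group A" "comm_group G" and f: "f \<in> hom A G"
    and 2: "\<And>a. a \<in> carrier A \<Longrightarrow> f a [^]\<^bsub>G\<^esub> (2::nat) = \<one>\<^bsub>G\<^esub>"
  obtains g where "g \<in> hom (tensor_F2 A) G" "\<And>a. a \<in> carrier A \<Longrightarrow> g (tensor_F2_map A a) = f a"
proof -
  let ?Z = "integer_mod_group 2"
  interpret A: comm_group A by fact
  interpret G: comm_group G by fact
  interpret f: group_hom A G f using f by (intro group_homI) auto
  have "f a \<otimes>\<^bsub>G\<^esub> f a = \<one>\<^bsub>G\<^esub>" if "a \<in> carrier A" for a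
    using 2 [OF that] that by (simp add: numeral_2_eq_2)
  \<comment> \<open>This is the map (a, k) to k f(a). Additivity in k at 1 + 1 = 0 is where 2 f(a) =
    0 enters.\<close>
  then have "bilinear_map A ?Z G (\<lambda>a k. if k = 0 then \<one>\<^bsub>G\<^esub> else f a)"
    by (auto simp: bilinear_map_def carrier_integer_mod_group_2)
  then obtain g where "g \<in> hom (tensor_product A ?Z) G"
      "\<And>a k. a \<in> carrier A \<Longrightarrow> k \<in> carrier ?Z \<Longrightarrow>
        g (pure_tensor A ?Z a k) = (if k = 0 then \<one>\<^bsub>G\<^esub> else f a)"
    using tensor_product_universal [OF assms(1) abelian_integer_mod_group assms(2)] by blast
  with that show thesis
    by (simp add: tensor_F2_def tensor_F2_map_def)
qed

section \<open>Unique factorization of quadratic maps\<close>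

lemma factors_uniquely_U_ab:
  assumes "quadratic_map M G q"
  shows "factors_uniquely M (U_ab M) (U_ab_map M) G q"
proof -
  have M: "comm_group M" and G: "comm_group G"
    using assms by (simp_all add: quadratic_map_def)
  interpret G: comm_group G by fact
  obtain f where f: "f \<in> hom (U_ab M) G" "\<And>m. m \<in> carrier M \<Longrightarrow> f (U_ab_map M m) = q m"
    using U_ab_universal [OF assms] by blast
  show ?thesis
  proof (rule factors_uniquelyI [OF _ f(1)])
    show "f (U_ab_map M m) = q m" if "m \<in> carrier M" for m
      using that by (rule f(2))
    show "group (U_ab M)"
      using comm_group_U_ab [OF M] by (simp add: comm_group_def)
    show "U_ab_map M \<in> carrier M \<rightarrow> carrier (U_ab M)"
      using quadratic_map_U_ab_map [OF M] by (simp add: quadratic_map_def)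
    show "g a = h a" if "g \<in> hom (U_ab M) G" "h \<in> hom (U_ab M) G"
      "\<And>m. m \<in> carrier M \<Longrightarrow> g (U_ab_map M m) = h (U_ab_map M m)" "a \<in> carrier (U_ab M)" for g h a
      using that by (rule U_ab_hom_eqI [OF M G.group_axioms])
  qed
qed

lemma factors_uniquely_U_ab_F2:
  assumes q: "quadratic_map M G q" and q2: "\<And>m. m \<in> carrier M \<Longrightarrow> q m [^]\<^bsub>G\<^esub> (2::nat) = \<one>\<^bsub>G\<^esub>"
  shows "factors_uniquely M (U_ab_F2 M) (U_ab_F2_map M) G q"
proof -
  let ?A = "U_ab M"
  have M: "comm_group M" and G: "comm_group G"
    using q by (simp_all add: quadratic_map_def)
  interpret G: comm_group G by fact
  note A = comm_group_U_ab [OF M]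
  have u: "U_ab_map M m \<in> carrier ?A" if "m \<in> carrier M" for m
    using quadratic_map_U_ab_map [OF M] that by (auto simp: quadratic_map_def)
  obtain f where f: "f \<in> hom ?A G" "\<And>m. m \<in> carrier M \<Longrightarrow> f (U_ab_map M m) = q m"
    using U_ab_universal [OF q] by blast
  \<comment> \<open>Doubled \<open>f\<close> and the trivial homomorphism agree on the generators
    \<open>U_ab_map M m\<close>, by \<open>q2\<close>.\<close>
  have f2: "f a [^]\<^bsub>G\<^esub> (2::nat) = \<one>\<^bsub>G\<^esub>" if "a \<in> carrier ?A" for a
    by (rule U_ab_hom_eqI [OF M G.group_axioms hom_pow2 [OF G f(1)] _ _ that])
      (auto simp: hom_def f(2) q2)
  obtain g where g: "g \<in> hom (tensor_F2 ?A) G"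
      "\<And>a. a \<in> carrier ?A \<Longrightarrow> g (tensor_F2_map ?A a) = f a"
    using tensor_F2_universal [OF A G f(1) f2] by blast
  note \<tau> = tensor_F2_map_hom [OF A]
  show ?thesis
    unfolding U_ab_F2_def
  proof (rule factors_uniquelyI [OF _ g(1)])
    show "group (tensor_F2 ?A)"
      using comm_group_tensor_F2 [OF A] by (simp add: comm_group_def)
    show "g (U_ab_F2_map M m) = q m" if "m \<in> carrier M" for m
      using that by (simp add: U_ab_F2_map_def g(2) u f(2))
    show "U_ab_F2_map M \<in> carrier M \<rightarrow> carrier (tensor_F2 ?A)"
      using u hom_in_carrier [OF \<tau>] by (auto simp: U_ab_F2_map_def)
    fix h k x
    assume h: "h \<in> hom (tensor_F2 ?A) G" and k: "k \<in> hom (tensor_F2 ?A) G"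
      and eq: "\<And>m. m \<in> carrier M \<Longrightarrow> h (U_ab_F2_map M m) = k (U_ab_F2_map M m)"
      and x: "x \<in> carrier (tensor_F2 ?A)"
    \<comment> \<open>Uniqueness passes through two generation statements: first from M to the
      abelianization, then from there to its tensor product with the field of two elements.\<close>
    have "(h \<circ> tensor_F2_map ?A) a = (k \<circ> tensor_F2_map ?A) a" if "a \<in> carrier ?A" for a
      using eq by (intro U_ab_hom_eqI [OF M G.group_axioms hom_compose [OF \<tau> h] hom_compose [OF \<tau> k] _ that])
        (simp add: U_ab_F2_map_def)
    then show "h x = k x"
      by (intro tensor_F2_hom_eqI [OF A G.group_axioms h k _ x]) simp
  qed
qed

theorem corollary2p2:
  fixes M :: "('a, 'm) monoid_scheme"
  assumes "comm_group M"
  shows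
    "(quadratic_map M (U_ab M) (U_ab_map M) \<and>
      (\<forall>(G :: ('g, 'n) monoid_scheme) q.
         comm_group G \<and> quadratic_map M G q \<longrightarrow>
         factors_uniquely M (U_ab M) (U_ab_map M) G q)) \<and>
     (quadratic_map M (U_ab_F2 M) (U_ab_F2_map M) \<and>
      (\<forall>m\<in>carrier M. U_ab_F2_map M m [^]\<^bsub>U_ab_F2 M\<^esub> (2::nat) = \<one>\<^bsub>U_ab_F2 M\<^esub>) \<and>
      (\<forall>(G :: ('g, 'n) monoid_scheme) q.
         comm_group G \<and> quadratic_map M G q \<and>
         (\<forall>m\<in>carrier M. q m [^]\<^bsub>G\<^esub> (2::nat) = \<one>\<^bsub>G\<^esub>) \<longrightarrow>
         factors_uniquely M (U_ab_F2 M) (U_ab_F2_map M) G q))"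
proof -
  note A = comm_group_U_ab [OF assms]
  note u = quadratic_map_U_ab_map [OF assms]
  \<comment> \<open>The map in (ii) is the one in (i) followed by the homomorphism sending a to the
    tensor of a with 1.\<close>
  have "quadratic_map M (U_ab_F2 M) (U_ab_F2_map M)"
    using quadratic_map_compose_hom [OF u comm_group_tensor_F2 [OF A] tensor_F2_map_hom [OF A]]
    by (simp add: U_ab_F2_def U_ab_F2_map_def [abs_def])
  moreover have "U_ab_F2_map M m [^]\<^bsub>U_ab_F2 M\<^esub> (2::nat) = \<one>\<^bsub>U_ab_F2 M\<^esub>"
    if "m \<in> carrier M" for m
    using tensor_F2_map_pow2 [OF A, of "U_ab_map M m"] u that
    by (auto simp: U_ab_F2_def U_ab_F2_map_def quadratic_map_def)
  ultimately show ?thesis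
    using u by (simp add: factors_uniquely_U_ab factors_uniquely_U_ab_F2)
qed

end
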